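(* Let $\phi(x,q_0,\ldots,q_t)$, $t\ge 1$, be a concave $1$-homogeneous $q$-function of order $t$ on an open interval $\mathcal{X}\subseteq\mathbb{R}$, let $\mathcal{P}$ be a class of probability distributions on $\mathcal{X}$ as described in the context, and let $S$ be the scoring rule generated by $\phi$, i.e. for $x\in\mathcal{X}$ and $Q\in\mathcal{P}$ with density $q(\cdot)$, $$S(x,Q)=\sum_{k=0}^t(-1)^k\frac{\mathrm{d}^k}{\mathrm{d}x^k}\Bigl[\frac{\partial\phi}{\partial q_k}\bigl\{x,q(x),q'(x),\ldots,q^{(t)}(x)\bigr\}\Bigr].$$ Suppose that the boundary divergence terms $d_+(P,Q)$ and $d_-(P,Q)$ vanish for all $P,Q\in\mathcal{P}$. Then $S$ is a proper scoring rule relative to $\mathcal{P}$. If moreover $\phi$ is strictly concave, then $S$ is strictly proper relative to $\mathcal{P}$.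
   Context: Let $\mathcal{X}\subseteq\mathbb{R}$ be an open interval (possibly unbounded), with lower and upper end-points denoted $-$ and $+$. A $q$-function of order $t$ is an infinitely differentiable real-valued function $\phi(x,\mathbf{q})=\phi(x,q_0,\ldots,q_t)$ on $\mathcal{X}\times\mathbb{R}^+\times\mathbb{R}^t$, with $x\in\mathcal{X}$, $q_0\in\mathbb{R}^+=(0,\infty)$, $q_1,\ldots,q_t\in\mathbb{R}$. It is $1$-homogeneous if $\phi(x,\lambda\mathbf{q})=\lambda\phi(x,\mathbf{q})$ for all $\lambda>0$. A $1$-homogeneous $q$-function $\phi$ is concave if $\phi(x,\mathbf{q}_1+\mathbf{q}_2)\le\phi(x,\mathbf{q}_1)+\phi(x,\mathbf{q}_2)$... with the inequality direction reversed, that is, if $$\phi(x,\mathbf{q}_1+\mathbf{q}_2)\ \ge\ \phi(x,\mathbf{q}_1)+\phi(x,\mathbf{q}_2)\quad\text{for all }x\in\mathcal{X},\ \mathbf{q}_1,\mathbf{q}_2\in\mathbb{R}^+\times\mathbb{R}^t$$ (equivalently, $\phi$ is concave in $\mathbf{q}$ in the usual sense for each $x$); it is strictly concave if, in addition, the inequality is strict whenever $\mathbf{q}_1,\mathbf{q}_2$ are linearly independent. $\mathcal{P}$ is a class of probability distributions on $\mathcal{X}$, each having a strictly positive Lebesgue density that is $2t$ times continuously differentiable, and such that the expected score $S(P,Q)=\int_{\mathcal{X}}p(x)S(x,Q)\,\mathrm{d}x$ exists and is finite for all $P,Q\in\mathcal{P}$. Densities of $P,Q$ are written $p(\cdot),q(\cdot)$.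 $S$ is proper relative to $\mathcal{P}$ if for every $P\in\mathcal{P}$ the minimum of $S(P,Q)$ over $Q\in\mathcal{P}$ is achieved at $Q=P$; it is strictly proper if moreover this minimum is attained only at $Q=P$. Boundary divergence terms. Let $D=\frac{\partial}{\partial x}+\sum_{j\ge0}q_{j+1}\frac{\partial}{\partial q_j}$ and, for $r\ge0$, $B_r\phi=\sum_{k\ge r+1}(-1)^{k-1-r}D^{k-1-r}\frac{\partial\phi}{\partial q_k}$ (a finite sum). For $P,Q\in\mathcal{P}$ let $$d_b(x)=\sum_{r\ge0}p^{(r)}(x)\Bigl[(B_r\phi)\bigl(x,q(x),q'(x),\ldots\bigr)-(B_r\phi)\bigl(x,p(x),p'(x),\ldots\bigr)\Bigr],$$ and define $d_+(P,Q)=-\lim_{x\to+}d_b(x)$ and $d_-(P,Q)=\lim_{x\to-}d_b(x)$, the limits being taken from within $\mathcal{X}$ at the upper and lower end-points respectively. *)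

theory Defs
  imports "HOL-Probability.Probability"
begin

text \<open>
  A \<open>q\<close>-function is encoded as \<open>\<phi> :: real \<Rightarrow> (nat \<Rightarrow> real) \<Rightarrow> real\<close>, where the sequence \<open>q\<close> holds
  the arguments \<open>q\<^sub>0, q\<^sub>1, \<dots>\<close>; order \<open>t\<close> means that only \<open>q\<^sub>0, \<dots>, q\<^sub>t\<close> matter.  This puts
  functions of different orders into one type, as the total derivative \<open>D\<close> raises the order.
\<close>

type_synonym qfun = "real \<Rightarrow> (nat \<Rightarrow> real) \<Rightarrow> real"

definition partial_x :: "qfun \<Rightarrow> qfun" where
  "partial_x f = (\<lambda>x q. deriv (\<lambda>s. f s q) x)"

definition partial_q :: "nat \<Rightarrow> qfun \<Rightarrow> qfun" where
  "partial_q k f = (\<lambda>x q. deriv (\<lambda>s. f x (q(k := s))) (q k))"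

inductive_set iterated_partials :: "qfun \<Rightarrow> qfun set" for \<phi> :: qfun where
  base: "\<phi> \<in> iterated_partials \<phi>"
| x: "f \<in> iterated_partials \<phi> \<Longrightarrow> partial_x f \<in> iterated_partials \<phi>"
| q: "f \<in> iterated_partials \<phi> \<Longrightarrow> partial_q k f \<in> iterated_partials \<phi>"

text \<open>
  Infinite differentiability: all iterated partial derivatives exist and are jointly continuous.
  Continuity refers to the product topology on sequences; for functions of \<open>x, q\<^sub>0, \<dots>, q\<^sub>t\<close>
  only, this is continuity in these \<open>t + 2\<close> real variables.
\<close>

definition q_function :: "real set \<Rightarrow> nat \<Rightarrow> qfun \<Rightarrow> bool" where
  "q_function X t \<phi> \<longleftrightarrow>
     (\<forall>x\<in>X. \<forall>q q'. 0 < q 0 \<and> (\<forall>i\<le>t. q i = q' i) \<longrightarrow> \<phi> x q = \<phi> x q') \<and>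
     (\<forall>f\<in>iterated_partials \<phi>.
        continuous_on (X \<times> {q. 0 < q 0}) (\<lambda>(x, q). f x q) \<and>
        (\<forall>x\<in>X. \<forall>q. 0 < q 0 \<longrightarrow>
           (\<lambda>s. f s q) differentiable (at x) \<and>
           (\<forall>k. (\<lambda>s. f x (q(k := s))) differentiable (at (q k)))))"

definition one_homogeneous :: "real set \<Rightarrow> qfun \<Rightarrow> bool" where
  "one_homogeneous X \<phi> \<longleftrightarrow>
     (\<forall>x\<in>X. \<forall>q c. 0 < q 0 \<and> 0 < c \<longrightarrow> \<phi> x (\<lambda>i. c * q i) = c * \<phi> x q)"

definition q_concave :: "real set \<Rightarrow> qfun \<Rightarrow> bool" where
  "q_concave X \<phi> \<longleftrightarrow>
     (\<forall>x\<in>X. \<forall>q1 q2. 0 < q1 0 \<and> 0 < q2 0 \<longrightarrow>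
        \<phi> x (\<lambda>i. q1 i + q2 i) \<ge> \<phi> x q1 + \<phi> x q2)"

definition lin_indep_upto :: "nat \<Rightarrow> (nat \<Rightarrow> real) \<Rightarrow> (nat \<Rightarrow> real) \<Rightarrow> bool" where
  "lin_indep_upto t q1 q2 \<longleftrightarrow>
     (\<forall>\<alpha> \<beta>. (\<forall>i\<le>t. \<alpha> * q1 i + \<beta> * q2 i = 0) \<longrightarrow> \<alpha> = 0 \<and> \<beta> = 0)"

definition q_strictly_concave :: "real set \<Rightarrow> nat \<Rightarrow> qfun \<Rightarrow> bool" where
  "q_strictly_concave X t \<phi> \<longleftrightarrow>
     q_concave X \<phi> \<and>
     (\<forall>x\<in>X. \<forall>q1 q2. 0 < q1 0 \<and> 0 < q2 0 \<and> lin_indep_upto t q1 q2 \<longrightarrow>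
        \<phi> x (\<lambda>i. q1 i + q2 i) > \<phi> x q1 + \<phi> x q2)"

text \<open>Meant for open \<open>X\<close>, where the two-sided \<^const>\<open>deriv\<close> is the derivative within \<open>X\<close>.\<close>

definition times_cont_differentiable_on :: "nat \<Rightarrow> (real \<Rightarrow> real) \<Rightarrow> real set \<Rightarrow> bool" where
  "times_cont_differentiable_on n f X \<longleftrightarrow>
     (\<forall>k<n. \<forall>x\<in>X. (deriv ^^ k) f differentiable (at x)) \<and>
     (\<forall>k\<le>n. continuous_on X ((deriv ^^ k) f))"

text \<open>
  \<open>P\<close> is a probability distribution on (the Borel sets of) \<open>X\<close> with density \<open>p\<close>; the values of \<open>p\<close>
  outside \<open>X\<close> are irrelevant.
\<close>

definition smooth_distribution :: "real set \<Rightarrow> nat \<Rightarrow> real measure \<Rightarrow> (real \<Rightarrow> real) \<Rightarrow> bool" where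
  "smooth_distribution X t P p \<longleftrightarrow>
     prob_space P \<and>
     P = density (restrict_space lborel X) (\<lambda>x. ennreal (p x)) \<and>
     (\<forall>x\<in>X. 0 < p x) \<and>
     times_cont_differentiable_on (2 * t) p X"

definition jet :: "(real \<Rightarrow> real) \<Rightarrow> real \<Rightarrow> nat \<Rightarrow> real" where
  "jet q x = (\<lambda>j. (deriv ^^ j) q x)"

text \<open>In the following, \<open>dens Q\<close> is the density of \<open>Q\<close>.\<close>

definition generated_score ::
    "qfun \<Rightarrow> nat \<Rightarrow> (real measure \<Rightarrow> real \<Rightarrow> real) \<Rightarrow> real \<Rightarrow> real measure \<Rightarrow> real" where
  "generated_score \<phi> t dens x Q =
     (\<Sum>k=0..t. (-1) ^ k * (deriv ^^ k) (\<lambda>y. partial_q k \<phi> y (jet (dens Q) y)) x)"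

definition expected_score ::
    "real set \<Rightarrow> (real measure \<Rightarrow> real \<Rightarrow> real) \<Rightarrow> (real \<Rightarrow> real measure \<Rightarrow> real) \<Rightarrow>
      real measure \<Rightarrow> real measure \<Rightarrow> real" where
  "expected_score X dens S P Q = (LBINT x:X. dens P x * S x Q)"

definition finite_expected_score ::
    "real set \<Rightarrow> (real measure \<Rightarrow> real \<Rightarrow> real) \<Rightarrow> (real \<Rightarrow> real measure \<Rightarrow> real) \<Rightarrow>
      real measure \<Rightarrow> real measure \<Rightarrow> bool" where
  "finite_expected_score X dens S P Q \<longleftrightarrow> set_integrable lborel X (\<lambda>x. dens P x * S x Q)"

definition proper_score ::
    "real set \<Rightarrow> (real measure \<Rightarrow> real \<Rightarrow> real) \<Rightarrow> real measure set \<Rightarrow>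
      (real \<Rightarrow> real measure \<Rightarrow> real) \<Rightarrow> bool" where
  "proper_score X dens \<P> S \<longleftrightarrow>
     (\<forall>P\<in>\<P>. \<forall>Q\<in>\<P>. expected_score X dens S P P \<le> expected_score X dens S P Q)"

definition strictly_proper_score ::
    "real set \<Rightarrow> (real measure \<Rightarrow> real \<Rightarrow> real) \<Rightarrow> real measure set \<Rightarrow>
      (real \<Rightarrow> real measure \<Rightarrow> real) \<Rightarrow> bool" where
  "strictly_proper_score X dens \<P> S \<longleftrightarrow>
     proper_score X dens \<P> S \<and>
     (\<forall>P\<in>\<P>. \<forall>Q\<in>\<P>. expected_score X dens S P Q = expected_score X dens S P P \<longrightarrow> Q = P)"

text \<open>
  For a function of some finite order, all but finitely many terms of the series are zero.
\<close>

definition total_deriv :: "qfun \<Rightarrow> qfun" where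
  "total_deriv f = (\<lambda>x q. partial_x f x q + (\<Sum>j. q (Suc j) * partial_q j f x q))"

text \<open>
  For \<open>\<phi>\<close> of order \<open>t\<close> the terms with \<open>k > t\<close> vanish, and hence so does \<open>B\<^sub>r \<phi>\<close> for \<open>r \<ge> t\<close>.
\<close>

definition boundary_op :: "nat \<Rightarrow> nat \<Rightarrow> qfun \<Rightarrow> qfun" where
  "boundary_op t r \<phi> =
     (\<lambda>x q. \<Sum>k=Suc r..t. (-1) ^ (k - 1 - r) * (total_deriv ^^ (k - 1 - r)) (partial_q k \<phi>) x q)"

definition d_b :: "qfun \<Rightarrow> nat \<Rightarrow> (real \<Rightarrow> real) \<Rightarrow> (real \<Rightarrow> real) \<Rightarrow> real \<Rightarrow> real" where
  "d_b \<phi> t p q x =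
     (\<Sum>r<t. (deriv ^^ r) p x *
        (boundary_op t r \<phi> x (jet q x) - boundary_op t r \<phi> x (jet p x)))"

text \<open>
  The limits at the end-points of \<^term>\<open>einterval a b\<close> are taken in the extended reals, which
  covers bounded and unbounded intervals.  The terms \<open>d\<^sub>+\<close> and \<open>d\<^sub>-\<close> are relations in their
  value, so that stating a value includes the existence of the limit.
\<close>

definition has_d_plus ::
    "ereal \<Rightarrow> qfun \<Rightarrow> nat \<Rightarrow> (real \<Rightarrow> real) \<Rightarrow> (real \<Rightarrow> real) \<Rightarrow> real \<Rightarrow> bool" where
  "has_d_plus b \<phi> t p q d \<longleftrightarrow> ((\<lambda>x. - d_b \<phi> t p q (real_of_ereal x)) \<longlongrightarrow> d) (at_left b)"

definition has_d_minus ::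
    "ereal \<Rightarrow> qfun \<Rightarrow> nat \<Rightarrow> (real \<Rightarrow> real) \<Rightarrow> (real \<Rightarrow> real) \<Rightarrow> real \<Rightarrow> bool" where
  "has_d_minus a \<phi> t p q d \<longleftrightarrow> ((\<lambda>x. d_b \<phi> t p q (real_of_ereal x)) \<longlongrightarrow> d) (at_right a)"

end

theory Submission
  imports Defs
begin

text \<open>
  Fix \<open>P\<close> and \<open>Q\<close> with densities \<open>p\<close> and \<open>q\<close>, and write \<open>\<phi>\<^sub>r\<close> for \<open>\<partial>\<phi>/\<partial>q\<^sub>r\<close>.  The score is the
  Euler--Lagrange expression of \<open>\<phi>\<close>, so integrating \<open>p\<close> times the score by parts shifts the
  derivatives onto \<open>p\<close>.  In differential form, and applied to the scores of \<open>Q\<close> and of \<open>P\<close>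
  (\<open>d_b_has_derivative\<close>),
  \<open>p(x) (S(x,Q) - S(x,P)) = G(x) - d\<^sub>b'(x)\<close> with \<open>G = (\<Sum>\<^sub>r p\<^sup>(\<^sup>r\<^sup>) \<phi>\<^sub>r(q)) - \<phi>(p)\<close>, where Euler's identity
  for the homogeneous \<open>\<phi>\<close> was used to sum up the terms that belong to \<open>P\<close>.  Now \<open>\<phi>(x, \<cdot>)\<close> is concave
  and homogeneous, so its tangent at the jet of \<open>q\<close> is the linear form with coefficients
  \<open>\<phi>\<^sub>r(q)\<close> and lies above \<open>\<phi>\<close> (\<open>tangent_inequality\<close>); that is, \<open>G \<ge> 0\<close>.  As \<open>d\<^sub>b\<close> vanishes at both
  end-points, integration gives \<open>S(P,Q) - S(P,P) = \<integral> G \<ge> 0\<close>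
  (\<open>integral_eq_of_vanishing_boundary\<close>).

  If \<open>S(P,Q) = S(P,P)\<close>, the continuous function \<open>G\<close> vanishes identically.  For strictly concave
  \<open>\<phi>\<close> the jets of \<open>p\<close> and \<open>q\<close> are then linearly dependent at every point
  (\<open>strict_tangent_inequality\<close>); as \<open>t \<ge> 1\<close>, the Wronskian \<open>p q' - p' q\<close> is zero, so \<open>p / q\<close> is
  constant on the interval, and the constant is \<open>1\<close> because both densities integrate to \<open>1\<close>.

  Most of the work is in justifying the calculus: the boundary terms are defined by the formal
  operator \<open>D\<close> on functions of infinitely many variables, and it has to be shown that \<open>D\<close> preserves
  smoothness (\<open>diff_alg_closed\<close>) and becomes \<open>d/dx\<close> along a jet (\<open>total_deriv_along_jet\<close>).
\<close>

section \<open>Functions of finitely many coordinates and their differential algebra\<close>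

text \<open>
  The clause that infinite differentiability imposes on each iterated partial derivative.  Partial
  differentiability alone would not give a chain rule; it does once the partials satisfy the
  clause too and hence are continuous.
\<close>

definition separately_smooth :: "real set \<Rightarrow> qfun \<Rightarrow> bool" where
  "separately_smooth X f \<longleftrightarrow>
     continuous_on (X \<times> {q. 0 < q 0}) (\<lambda>(x, q). f x q) \<and>
     (\<forall>x\<in>X. \<forall>q. 0 < q 0 \<longrightarrow>
        (\<lambda>s. f s q) differentiable (at x) \<and>
        (\<forall>k. (\<lambda>s. f x (q(k := s))) differentiable (at (q k))))"

definition order_at_most :: "real set \<Rightarrow> nat \<Rightarrow> qfun \<Rightarrow> bool" where
  "order_at_most X m f \<longleftrightarrow>
     (\<forall>x\<in>X. \<forall>q q'. 0 < q 0 \<and> (\<forall>i\<le>m. q i = q' i) \<longrightarrow> f x q = f x q')"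

text \<open>
  Iterating \<open>D f = \<partial>\<^sub>x f + (\<Sum>j. q\<^sub>j\<^sub>+\<^sub>1 \<partial>\<^sub>j f)\<close> on \<open>\<phi>\<close> gives polynomials in the coordinates \<open>q\<^sub>j\<close> and the
  iterated partials of \<open>\<phi>\<close>.  The algebra generated by these functions is closed under all partial
  derivatives, so that the smoothness of \<open>\<phi>\<close> carries over to every \<open>D\<^sup>n\<close> of its partials.  The rule
  \<open>cong\<close> is needed because \<^const>\<open>deriv\<close> obeys the sum and product rules only where the derivatives
  exist, and these are known only for \<open>x \<in> X\<close> and \<open>q\<^sub>0 > 0\<close>.
\<close>

inductive_set diff_alg :: "real set \<Rightarrow> qfun \<Rightarrow> qfun set" for X :: "real set" and \<phi> :: qfun where
  generator: "f \<in> iterated_partials \<phi> \<Longrightarrow> f \<in> diff_alg X \<phi>"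
| coordinate: "(\<lambda>x q. q j) \<in> diff_alg X \<phi>"
| const: "(\<lambda>x q. c) \<in> diff_alg X \<phi>"
| add: "f \<in> diff_alg X \<phi> \<Longrightarrow> g \<in> diff_alg X \<phi> \<Longrightarrow> (\<lambda>x q. f x q + g x q) \<in> diff_alg X \<phi>"
| mult: "f \<in> diff_alg X \<phi> \<Longrightarrow> g \<in> diff_alg X \<phi> \<Longrightarrow> (\<lambda>x q. f x q * g x q) \<in> diff_alg X \<phi>"
| cong: "f \<in> diff_alg X \<phi> \<Longrightarrow> (\<And>x q. x \<in> X \<Longrightarrow> 0 < q 0 \<Longrightarrow> g x q = f x q) \<Longrightarrow> g \<in> diff_alg X \<phi>"

lemma separately_smoothD:
  assumes "separately_smooth X f" "x \<in> X" "0 < q 0"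
  shows "((\<lambda>s. f s q) has_real_derivative partial_x f x q) (at x)"
    and "((\<lambda>s. f x (q(k := s))) has_real_derivative partial_q k f x q) (at (q k))"
  using assms
  by (auto simp: separately_smooth_def partial_x_def partial_q_def DERIV_deriv_iff_real_differentiable)

lemma separately_smoothI:
  assumes "continuous_on (X \<times> {q. 0 < q 0}) (\<lambda>(x, q). f x q)"
    and "\<And>x q. x \<in> X \<Longrightarrow> 0 < q 0 \<Longrightarrow> ((\<lambda>s. f s q) has_real_derivative fx x q) (at x)"
    and "\<And>x q k. x \<in> X \<Longrightarrow> 0 < q 0 \<Longrightarrow>
           ((\<lambda>s. f x (q(k := s))) has_real_derivative fq k x q) (at (q k))"
  shows "separately_smooth X f"
    and "\<And>x q. x \<in> X \<Longrightarrow> 0 < q 0 \<Longrightarrow> partial_x f x q = fx x q"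
    and "\<And>x q k. x \<in> X \<Longrightarrow> 0 < q 0 \<Longrightarrow> partial_q k f x q = fq k x q"
  using assms
  unfolding separately_smooth_def partial_x_def partial_q_def real_differentiable_def
  by (blast, auto intro!: DERIV_imp_deriv)

text \<open>
  The condition \<open>q\<^sub>0 > 0\<close> is open in each coordinate, so a partial derivative at a point of the
  domain depends only on values inside the domain.
\<close>

lemma eventually_upd_positive:
  fixes q :: "nat \<Rightarrow> real"
  assumes "0 < q 0"
  shows "\<forall>\<^sub>F s in nhds (q k). 0 < (q(k := s)) 0"
proof (cases "k = 0")
  case True
  then show ?thesis
    using eventually_nhds_in_open[of "{0<..}" "q k"] assms by (auto elim!: eventually_mono)
qed (use assms in auto)

lemma partial_q_cong:
  assumes "0 < q 0" "q k = q' k"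
    "\<And>s. 0 < (q(k := s)) 0 \<Longrightarrow> f x (q(k := s)) = g x (q'(k := s))"
  shows "partial_q k f x q = partial_q k g x q'"
  unfolding partial_q_def
  using eventually_upd_positive[of q k] assms
  by (intro deriv_cong_ev) (auto elim!: eventually_mono)

lemma order_at_most_partial_x:
  assumes "open X" "order_at_most X m f"
  shows "order_at_most X m (partial_x f)"
  unfolding order_at_most_def
proof safe
  fix x q q'
  assume "x \<in> X" "0 < (q 0 :: real)" and eq: "\<forall>i\<le>m. q i = q' i"
  then have "\<forall>\<^sub>F s in nhds x. f s q = f s q'"
    using assms eventually_nhds_in_open[of X x]
    by (auto elim!: eventually_mono simp: order_at_most_def)
  then show "partial_x f x q = partial_x f x q'"
    unfolding partial_x_def by (rule deriv_cong_ev) simp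
qed

lemma partial_q_beyond_order:
  assumes "order_at_most X m f" "x \<in> X" "0 < q 0" "m < k"
  shows "partial_q k f x q = 0"
proof -
  have "partial_q k f x q = partial_q k (\<lambda>x _. f x q) x q"
    using assms by (intro partial_q_cong) (auto simp: order_at_most_def)
  then show ?thesis by (simp add: partial_q_def)
qed

lemma order_at_most_partial_q:
  assumes "order_at_most X m f"
  shows "order_at_most X m (partial_q k f)"
  unfolding order_at_most_def
proof safe
  fix x q q'
  assume *: "x \<in> X" "0 < (q 0 :: real)" "\<forall>i\<le>m. q i = q' i"
  show "partial_q k f x q = partial_q k f x q'"
  proof (cases "k \<le> m")
    case True
    then show ?thesis
      using * assms by (intro partial_q_cong) (auto simp: order_at_most_def)
  next
    case False
    then show ?thesis
      using * assms partial_q_beyond_order[of X m f x _ k] by (metis le0 not_le)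
  qed
qed

text \<open>
  For a function of finite order the series in \<^const>\<open>total_deriv\<close> breaks off.
\<close>

lemma total_deriv_finite_sum:
  assumes "order_at_most X m f" "x \<in> X" "0 < q 0"
  shows "total_deriv f x q = partial_x f x q + (\<Sum>j\<le>m. q (Suc j) * partial_q j f x q)"
proof -
  have "(\<Sum>j. q (Suc j) * partial_q j f x q) = (\<Sum>j\<le>m. q (Suc j) * partial_q j f x q)"
    using partial_q_beyond_order[where q = q, OF assms] by (intro suminf_finite) auto
  then show ?thesis by (simp add: total_deriv_def)
qed

lemma order_at_most_total_deriv:
  assumes "open X" "order_at_most X m f"
  shows "order_at_most X (Suc m) (total_deriv f)"
  unfolding order_at_most_def
proof safe
  fix x q q'
  assume *: "x \<in> X" "0 < (q 0 :: real)" "\<forall>i\<le>Suc m. q i = q' i"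
  then have "0 < q' 0" by (metis le0)
  moreover have "partial_x f x q = partial_x f x q'"
    using order_at_most_partial_x[OF assms] * by (auto simp: order_at_most_def)
  moreover have "partial_q j f x q = partial_q j f x q'" for j
    using order_at_most_partial_q[OF assms(2)] * by (auto simp: order_at_most_def)
  ultimately show "total_deriv f x q = total_deriv f x q'"
    using * assms(2) by (simp add: total_deriv_finite_sum)
qed

lemma order_at_most_total_deriv_iterate:
  assumes "open X" "order_at_most X m f"
  shows "order_at_most X (m + n) ((total_deriv ^^ n) f)"
  by (induction n) (use assms order_at_most_total_deriv in auto)

lemma diff_alg_closedI:
  assumes c: "continuous_on (X \<times> {q. 0 < q 0}) (\<lambda>(x, q). f x q)"
    and d0: "\<And>x q. x \<in> X \<Longrightarrow> 0 < q 0 \<Longrightarrow> ((\<lambda>s. f s q) has_real_derivative fx x q) (at x)"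
    and d1: "\<And>x q k. x \<in> X \<Longrightarrow> 0 < q 0 \<Longrightarrow>
           ((\<lambda>s. f x (q(k := s))) has_real_derivative fq k x q) (at (q k))"
    and fx: "fx \<in> diff_alg X \<phi>" and fq: "\<And>k. fq k \<in> diff_alg X \<phi>"
  shows "separately_smooth X f \<and> partial_x f \<in> diff_alg X \<phi> \<and> (\<forall>k. partial_q k f \<in> diff_alg X \<phi>)"
proof (intro conjI allI)
  show "separately_smooth X f"
    using c d0 d1 by (rule separately_smoothI(1))
  show "partial_x f \<in> diff_alg X \<phi>"
    using fx by (rule diff_alg.cong) (rule separately_smoothI(2)[OF c d0 d1])
  show "partial_q k f \<in> diff_alg X \<phi>" for k
    using fq[of k] by (rule diff_alg.cong) (rule separately_smoothI(3)[OF c d0 d1])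
qed

text \<open>
  Structural induction: the sum and product rules express the partials of a composite element by
  elements of the algebra again.
\<close>

lemma diff_alg_closed:
  assumes X: "open X" and \<phi>: "\<And>f. f \<in> iterated_partials \<phi> \<Longrightarrow> separately_smooth X f"
    and "f \<in> diff_alg X \<phi>"
  shows "separately_smooth X f \<and> partial_x f \<in> diff_alg X \<phi> \<and> (\<forall>k. partial_q k f \<in> diff_alg X \<phi>)"
  using assms(3)
proof induction
  case (generator f)
  then show ?case
    using \<phi> by (auto intro: diff_alg.generator iterated_partials.intros)
next
  case (coordinate j)
  have "continuous_on (X \<times> {q. 0 < q 0}) (\<lambda>(x, q). (q :: nat \<Rightarrow> real) j)"
    unfolding case_prod_beta
    by (rule continuous_on_compose2[OF continuous_on_product_coordinates]) (auto intro: continuous_intros)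
  moreover have "((\<lambda>s. (q(k := s)) j) has_real_derivative (if k = j then 1 else 0)) (at (q k))"
    for q :: "nat \<Rightarrow> real" and k
    by auto
  ultimately show ?case
    by (intro diff_alg_closedI[where fx = "\<lambda>x q. 0" and fq = "\<lambda>k x q. if k = j then 1 else 0"])
      (auto intro: diff_alg.const)
next
  case (const c)
  have "continuous_on (X \<times> {q. 0 < q 0}) (\<lambda>(x, q). c)"
    by (simp add: case_prod_beta)
  then show ?case
    by (intro diff_alg_closedI[where fx = "\<lambda>x q. 0" and fq = "\<lambda>k x q. 0"])
      (auto intro: diff_alg.const)
next
  case (add f g)
  then have f: "separately_smooth X f" and g: "separately_smooth X g"
    and in_alg: "partial_x f \<in> diff_alg X \<phi>" "partial_x g \<in> diff_alg X \<phi>"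
      "\<And>k. partial_q k f \<in> diff_alg X \<phi>" "\<And>k. partial_q k g \<in> diff_alg X \<phi>"
    by auto
  have "continuous_on (X \<times> {q. 0 < q 0}) (\<lambda>(x, q). f x q + g x q)"
    using f g unfolding separately_smooth_def case_prod_beta by (auto intro: continuous_on_add)
  then show ?case
    using DERIV_add[OF separately_smoothD(1)[OF f] separately_smoothD(1)[OF g]]
      DERIV_add[OF separately_smoothD(2)[OF f] separately_smoothD(2)[OF g]]
    by (rule diff_alg_closedI) (assumption | intro diff_alg.add in_alg)+
next
  case (mult f g)
  then have f: "separately_smooth X f" and g: "separately_smooth X g"
    and in_alg: "partial_x f \<in> diff_alg X \<phi>" "partial_x g \<in> diff_alg X \<phi>"
      "\<And>k. partial_q k f \<in> diff_alg X \<phi>" "\<And>k. partial_q k g \<in> diff_alg X \<phi>"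
    by auto
  have c: "continuous_on (X \<times> {q. 0 < q 0}) (\<lambda>(x, q). f x q * g x q)"
    using f g unfolding separately_smooth_def case_prod_beta by (auto intro: continuous_on_mult)
  have k: "((\<lambda>s. f x (q(k := s)) * g x (q(k := s))) has_real_derivative
      partial_q k f x q * g x q + partial_q k g x q * f x q) (at (q k))"
    if "x \<in> X" "0 < q 0" for x q k
    using DERIV_mult[OF separately_smoothD(2)[where q = q, OF f that]
        separately_smoothD(2)[where q = q, OF g that], of k]
    by simp
  show ?case
    using c DERIV_mult[OF separately_smoothD(1)[OF f] separately_smoothD(1)[OF g]] k
    by (rule diff_alg_closedI) (assumption | intro diff_alg.add diff_alg.mult in_alg mult.hyps)+
next
  case (cong f g)
  then have f: "separately_smooth X f" and in_alg: "partial_x f \<in> diff_alg X \<phi>"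
    "\<And>k. partial_q k f \<in> diff_alg X \<phi>"
    by auto
  have "continuous_on (X \<times> {q. 0 < q 0}) (\<lambda>(x, q). f x q)"
    using f by (simp add: separately_smooth_def)
  then have "continuous_on (X \<times> {q. 0 < q 0}) (\<lambda>(x, q). g x q)"
    by (rule continuous_on_eq) (use cong(2) in auto)
  moreover have "((\<lambda>s. g s q) has_real_derivative partial_x f x q) (at x)"
    if "x \<in> X" "0 < q 0" for x q
    by (rule has_field_derivative_transform_within_open[OF separately_smoothD(1)[where q = q, OF f that] X])
      (use that cong(2) in auto)
  moreover have "((\<lambda>s. g x (q(k := s))) has_real_derivative partial_q k f x q) (at (q k))"
    if "x \<in> X" "0 < q 0" for x q k
    by (rule iffD2[OF DERIV_cong_ev[OF refl _ refl] separately_smoothD(2)[where q = q, OF f that]])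
      (use eventually_upd_positive[of q k, OF that(2)] that cong(2) in \<open>auto elim!: eventually_mono\<close>)
  ultimately show ?case
    using in_alg by (rule diff_alg_closedI)
qed

lemma diff_alg_sum:
  "(\<And>j. j < (n::nat) \<Longrightarrow> f j \<in> diff_alg X \<phi>) \<Longrightarrow> (\<lambda>x q. \<Sum>j<n. f j x q) \<in> diff_alg X \<phi>"
  by (induction n) (auto intro: diff_alg.intros)

lemma diff_alg_total_deriv:
  assumes "open X" "\<And>f. f \<in> iterated_partials \<phi> \<Longrightarrow> separately_smooth X f"
    "f \<in> diff_alg X \<phi>" "order_at_most X m f"
  shows "total_deriv f \<in> diff_alg X \<phi>"
proof (rule diff_alg.cong)
  have "partial_x f \<in> diff_alg X \<phi>" "partial_q k f \<in> diff_alg X \<phi>" for k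
    using diff_alg_closed[OF assms(1-3)] by auto
  then show "(\<lambda>x q. partial_x f x q + (\<Sum>j<Suc m. q (Suc j) * partial_q j f x q)) \<in> diff_alg X \<phi>"
    by (intro diff_alg.add diff_alg_sum diff_alg.mult diff_alg.coordinate) auto
  show "total_deriv f x q = partial_x f x q + (\<Sum>j<Suc m. q (Suc j) * partial_q j f x q)"
    if "x \<in> X" "0 < q 0" for x q
    using total_deriv_finite_sum[where q = q, OF assms(4) that] by (simp add: lessThan_Suc_atMost)
qed

section \<open>The chain rule\<close>

lemma continuous_on_curve:
  assumes f: "separately_smooth X f"
    and "continuous_on T \<xi>" "\<And>j. continuous_on T (\<lambda>s. \<gamma> s j)"
    and "\<And>s. s \<in> T \<Longrightarrow> \<xi> s \<in> X \<and> 0 < \<gamma> s 0"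
  shows "continuous_on T (\<lambda>s. f (\<xi> s) (\<gamma> s))"
proof -
  have "continuous_on (X \<times> {q. 0 < q 0}) (\<lambda>(x, q). f x q)"
    using f by (auto simp: separately_smooth_def)
  moreover have "continuous_on T (\<lambda>s. (\<xi> s, \<gamma> s))"
    using assms by (intro continuous_on_Pair continuous_on_coordinatewise_then_product)
  ultimately have "continuous_on T (\<lambda>s. case (\<xi> s, \<gamma> s) of (x, q) \<Rightarrow> f x q)"
    by (rule continuous_on_compose2) (use assms(4) in auto)
  then show ?thesis by simp
qed

text \<open>
  Here only the first \<open>n\<close> coordinates move along the curve \<open>\<gamma>\<close>; the others stay at \<open>c\<close>.
  Letting one more coordinate move is a composition with a function of two real variables, the
  parameter and the new coordinate.  For the latter, total differentiability follows from the
  existence of one partial derivative and the continuity of the other, so the induction on \<open>n\<close>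
  replaces a multivariate differentiability statement on the sequence space.
\<close>

lemma chain_rule_first_coordinates:
  assumes T: "open T"
    and f: "separately_smooth X f" "\<And>k. separately_smooth X (partial_q k f)"
    and \<xi>: "\<And>s. s \<in> T \<Longrightarrow> \<xi> s \<in> X" "\<And>s. s \<in> T \<Longrightarrow> (\<xi> has_real_derivative \<xi>' s) (at s)"
    and pos: "\<And>s. s \<in> T \<Longrightarrow> 0 < \<gamma> s 0"
    and \<gamma>: "\<And>s j. s \<in> T \<Longrightarrow> j < n \<Longrightarrow> ((\<lambda>s. \<gamma> s j) has_real_derivative \<gamma>' s j) (at s)"
    and s: "s \<in> T" and c: "0 < c 0"
  defines "\<delta> \<equiv> \<lambda>n c s j. if j < n then \<gamma> s j else (c :: nat \<Rightarrow> real) j"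
  shows "((\<lambda>s. f (\<xi> s) (\<delta> n c s)) has_real_derivative
           \<xi>' s * partial_x f (\<xi> s) (\<delta> n c s) +
           (\<Sum>j<n. \<gamma>' s j * partial_q j f (\<xi> s) (\<delta> n c s))) (at s)"
  using \<gamma> c
proof (induction n arbitrary: c)
  case 0
  have "((\<lambda>s. f s c) has_real_derivative partial_x f (\<xi> s) c) (at (\<xi> s))"
    using separately_smoothD(1)[OF f(1)] \<xi> s 0 by blast
  from DERIV_chain2[OF this \<xi>(2)[OF s]] show ?case
    by (simp add: \<delta>_def mult.commute)
next
  case (Suc n)
  have \<delta>_pos: "0 < \<delta> m d r 0" if "r \<in> T" "0 < d 0" for m d r
    using that pos by (auto simp: \<delta>_def)
  \<comment> \<open>The range of the new coordinate: \<open>q\<^sub>0\<close> has to stay positive, the others are unrestricted.\<close>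
  define Y where "Y = {y :: real. n = 0 \<longrightarrow> 0 < y}"
  have Y: "convex Y" "open Y"
    unfolding Y_def by (cases "n = 0"; simp add: greaterThan_def[symmetric])+
  have cont_\<gamma>: "continuous_on T (\<lambda>s. \<gamma> s j)" if "j < n" for j
    using Suc.prems(1) that
    by (intro continuous_at_imp_continuous_on ballI DERIV_isCont) (auto simp: less_Suc_eq)
  have cont_\<xi>: "continuous_on T \<xi>"
    using \<xi>(2) by (intro continuous_at_imp_continuous_on ballI DERIV_isCont) auto
  \<comment> \<open>\<open>g r y\<close> has the first \<open>n\<close> coordinates on the curve at parameter \<open>r\<close> and the next one equal to \<open>y\<close>.\<close>
  define g where "g = (\<lambda>r y. f (\<xi> r) (\<delta> n (c(n := y)) r))"
  define h where "h = (\<lambda>r y. partial_q n f (\<xi> r) (\<delta> n (c(n := y)) r))"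
  have upd: "\<delta> n (c(n := y)) r = (\<delta> n c r)(n := y)" for y r
    by (auto simp: \<delta>_def)
  have upd_pos: "0 < \<delta> n (c(n := y)) r 0" if "r \<in> T" "y \<in> Y" for r y
    using that pos Suc.prems(2) by (auto simp: \<delta>_def Y_def)
  have Suc_eq: "\<delta> (Suc n) c r = \<delta> n (c(n := \<gamma> r n)) r" for r
    by (auto simp: \<delta>_def)
  have y0: "\<gamma> r n \<in> Y" if "r \<in> T" for r
    using pos that by (auto simp: Y_def)
  define D where "D = \<xi>' s * partial_x f (\<xi> s) (\<delta> (Suc n) c s) +
      (\<Sum>j<n. \<gamma>' s j * partial_q j f (\<xi> s) (\<delta> (Suc n) c s))"
  \<comment> \<open>By the induction hypothesis, with the new coordinate fixed at its value for \<open>s\<close>.\<close>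
  have gx: "((\<lambda>r. g r (\<gamma> s n)) has_real_derivative D) (at s)"
    unfolding g_def D_def Suc_eq using Suc.prems y0[OF s]
    by (intro Suc.IH) (auto simp: less_Suc_eq Y_def)
  have gy: "(g r has_derivative blinfun_apply (blinfun_mult_right (h r y))) (at y within Y)"
    if "r \<in> T" "y \<in> Y" for r y
  proof -
    have "((\<lambda>z. f (\<xi> r) ((\<delta> n (c(n := y)) r)(n := z))) has_real_derivative h r y)
        (at ((\<delta> n (c(n := y)) r) n))"
      unfolding h_def using \<xi>(1) upd_pos that by (intro separately_smoothD(2)[OF f(1)]) auto
    then have "(g r has_real_derivative h r y) (at y)"
      by (simp add: g_def upd)
    then show ?thesis
      by (simp add: has_field_derivative_def has_derivative_at_withinI)
  qed
  have "continuous_on (T \<times> Y) (\<lambda>p. h (fst p) (snd p))"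
    unfolding h_def
  proof (rule continuous_on_curve[OF f(2)])
    show "continuous_on (T \<times> Y) (\<lambda>p. \<xi> (fst p))"
      by (rule continuous_on_compose2[OF cont_\<xi>]) (auto intro: continuous_intros)
    fix j
    have "continuous_on (T \<times> Y) (\<lambda>p. \<gamma> (fst p) j)" if "j < n"
      by (rule continuous_on_compose2[OF cont_\<gamma>[OF that]]) (auto intro: continuous_intros)
    then show "continuous_on (T \<times> Y) (\<lambda>p. \<delta> n (c(n := snd p)) (fst p) j)"
      by (cases j n rule: linorder_cases) (auto simp: \<delta>_def intro: continuous_intros)
  qed (use \<xi>(1) upd_pos in auto)
  then have "continuous_on (T \<times> Y) (\<lambda>p. blinfun_mult_right (h (fst p) (snd p)))"
    by (rule bounded_linear.continuous_on[OF bounded_linear_blinfun_mult_right])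
  then have "continuous (at (s, \<gamma> s n) within T \<times> Y) (\<lambda>p. blinfun_mult_right (h (fst p) (snd p)))"
    using s y0[OF s] by (simp add: continuous_on_eq_continuous_within)
  then have gy_cont: "continuous (at (s, \<gamma> s n) within T \<times> Y) (\<lambda>(r, y). blinfun_mult_right (h r y))"
    by (simp only: case_prod_unfold)
  have "((\<lambda>(r, y). g r y) has_derivative
      (\<lambda>(u, v). D * u + blinfun_apply (blinfun_mult_right (h s (\<gamma> s n))) v))
      (at (s, \<gamma> s n) within T \<times> Y)"
    using has_derivative_at_withinI[OF gx[unfolded has_field_derivative_def]] gy gy_cont
      y0[OF s] Y(1) by (rule has_derivative_partialsI)
  then have total: "((\<lambda>(r, y). g r y) has_derivative (\<lambda>(u, v). D * u + h s (\<gamma> s n) * v))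
      (at (s, \<gamma> s n))"
    using at_within_open[of "(s, \<gamma> s n)" "T \<times> Y"] s y0 T Y by (simp add: open_Times)
  have "((\<lambda>r. (r, \<gamma> r n)) has_derivative (\<lambda>u. (u, \<gamma>' s n * u))) (at s)"
    using Suc.prems(1)[OF s, of n]
    by (intro has_derivative_Pair) (auto simp: has_field_derivative_def)
  from has_derivative_compose[OF this total]
  have "((\<lambda>r. g r (\<gamma> r n)) has_derivative (\<lambda>u. D * u + h s (\<gamma> s n) * (\<gamma>' s n * u))) (at s)"
    by simp
  moreover have "(\<lambda>u. D * u + h s (\<gamma> s n) * (\<gamma>' s n * u)) = (*) (D + \<gamma>' s n * h s (\<gamma> s n))"
    by (auto simp: algebra_simps)
  ultimately have "((\<lambda>r. g r (\<gamma> r n)) has_real_derivative D + \<gamma>' s n * h s (\<gamma> s n)) (at s)"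
    by (simp add: has_field_derivative_def)
  then show ?case
    by (simp add: g_def h_def D_def Suc_eq[symmetric] add.assoc)
qed

text \<open>
  A function of order \<open>m\<close> does not depend on the coordinates beyond \<open>m\<close>, so these may be held
  constant and only finitely many coordinates move.
\<close>

lemma chain_rule:
  assumes "open X" "open T"
    and f: "separately_smooth X f" "\<And>k. separately_smooth X (partial_q k f)" "order_at_most X m f"
    and \<xi>: "\<And>s. s \<in> T \<Longrightarrow> \<xi> s \<in> X" "\<And>s. s \<in> T \<Longrightarrow> (\<xi> has_real_derivative \<xi>' s) (at s)"
    and pos: "\<And>s. s \<in> T \<Longrightarrow> 0 < \<gamma> s 0"
    and \<gamma>: "\<And>s j. s \<in> T \<Longrightarrow> j \<le> m \<Longrightarrow> ((\<lambda>s. \<gamma> s j) has_real_derivative \<gamma>' s j) (at s)"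
    and s: "s \<in> T"
  shows "((\<lambda>s. f (\<xi> s) (\<gamma> s)) has_real_derivative
           \<xi>' s * partial_x f (\<xi> s) (\<gamma> s) + (\<Sum>j\<le>m. \<gamma>' s j * partial_q j f (\<xi> s) (\<gamma> s))) (at s)"
proof -
  define \<delta> where "\<delta> = (\<lambda>s j. if j < Suc m then \<gamma> s j else (1 :: real))"
  have eq: "g (\<xi> r) (\<delta> r) = g (\<xi> r) (\<gamma> r)" if "order_at_most X m g" "r \<in> T" for g r
    using that \<xi>(1) pos unfolding order_at_most_def
    by (auto simp: \<delta>_def)
  have "((\<lambda>s. f (\<xi> s) (\<delta> s)) has_real_derivative
           \<xi>' s * partial_x f (\<xi> s) (\<delta> s) + (\<Sum>j<Suc m. \<gamma>' s j * partial_q j f (\<xi> s) (\<delta> s))) (at s)"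
    unfolding \<delta>_def
    using \<gamma> s by (intro chain_rule_first_coordinates[where \<gamma> = \<gamma> and n = "Suc m", OF assms(2) f(1,2) \<xi> pos]) auto
  then have "((\<lambda>s. f (\<xi> s) (\<delta> s)) has_real_derivative
           \<xi>' s * partial_x f (\<xi> s) (\<gamma> s) + (\<Sum>j\<le>m. \<gamma>' s j * partial_q j f (\<xi> s) (\<gamma> s))) (at s)"
    using eq[OF order_at_most_partial_x[OF \<open>open X\<close> f(3)] s] eq[OF order_at_most_partial_q[OF f(3)] s]
    by (simp add: lessThan_Suc_atMost)
  then show ?thesis
    by (rule has_field_derivative_transform_within_open[OF _ assms(2) s]) (rule eq[OF f(3)])
qed

section \<open>Differentiation along jets\<close>

locale smooth_qfun =
  fixes X :: "real set" and t :: nat and \<phi> :: qfun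
  assumes open_X: "open X" and q_function: "q_function X t \<phi>"
begin

lemma smooth_partials: "f \<in> iterated_partials \<phi> \<Longrightarrow> separately_smooth X f"
  using q_function unfolding q_function_def separately_smooth_def by blast

lemma diff_alg_smooth:
  assumes "f \<in> diff_alg X \<phi>"
  shows "separately_smooth X f" "separately_smooth X (partial_q k f)"
  using diff_alg_closed[OF open_X smooth_partials] assms by blast+

lemma order_phi: "order_at_most X t \<phi>"
  using q_function unfolding q_function_def order_at_most_def by blast

text \<open>
  This is the purpose of \<open>D\<close>: substituting a jet turns it into the derivative in \<open>x\<close>.
\<close>

lemma total_deriv_along_jet:
  assumes f: "f \<in> diff_alg X \<phi>" "order_at_most X m f"
    and q: "\<And>x. x \<in> X \<Longrightarrow> 0 < q x"
      "\<And>x j. x \<in> X \<Longrightarrow> j \<le> m \<Longrightarrow> (deriv ^^ j) q differentiable (at x)"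
    and x: "x \<in> X"
  shows "((\<lambda>y. f y (jet q y)) has_real_derivative total_deriv f x (jet q x)) (at x)"
proof -
  have "((\<lambda>y. f y (jet q y)) has_real_derivative
      1 * partial_x f x (jet q x) + (\<Sum>j\<le>m. jet q x (Suc j) * partial_q j f x (jet q x))) (at x)"
    using q x unfolding jet_def
    by (intro chain_rule[OF open_X open_X diff_alg_smooth[OF f(1)] f(2)])
      (auto simp: DERIV_deriv_iff_real_differentiable)
  then show ?thesis
    using total_deriv_finite_sum[where q = "jet q x", OF f(2) x] q x by (simp add: jet_def)
qed

lemma iterate_total_deriv_in_diff_alg: "(total_deriv ^^ n) (partial_q k \<phi>) \<in> diff_alg X \<phi>"
proof (induction n)
  case (Suc n)
  show ?case
    using diff_alg_total_deriv[OF open_X smooth_partials Suc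
        order_at_most_total_deriv_iterate[OF open_X order_at_most_partial_q[OF order_phi]]]
    by simp
qed (auto intro: diff_alg.generator iterated_partials.intros)

text \<open>
  By lemma \<open>deriv_iterate_partial\<close> below, this is the \<open>n\<close>-th derivative in \<open>x\<close> of \<open>\<partial>\<phi>/\<partial>q\<^sub>k\<close> along the
  jet of \<open>q\<close>, for \<open>n \<le> t\<close>.
\<close>

definition partial_along_jet :: "(real \<Rightarrow> real) \<Rightarrow> nat \<Rightarrow> nat \<Rightarrow> real \<Rightarrow> real" where
  "partial_along_jet q k n x = (total_deriv ^^ n) (partial_q k \<phi>) x (jet q x)"

definition smooth_density :: "(real \<Rightarrow> real) \<Rightarrow> bool" where
  "smooth_density q \<longleftrightarrow> (\<forall>x\<in>X. 0 < q x) \<and> times_cont_differentiable_on (2 * t) q X"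

lemma smooth_densityD:
  assumes "smooth_density q"
  shows "x \<in> X \<Longrightarrow> 0 < q x"
    and "k < 2 * t \<Longrightarrow> x \<in> X \<Longrightarrow> ((deriv ^^ k) q has_real_derivative (deriv ^^ Suc k) q x) (at x)"
    and "k \<le> 2 * t \<Longrightarrow> continuous_on X ((deriv ^^ k) q)"
  using assms
  by (auto simp: smooth_density_def times_cont_differentiable_on_def
      DERIV_deriv_iff_real_differentiable)

text \<open>
  \<open>D\<^sup>n (\<partial>\<phi>/\<partial>q\<^sub>k)\<close> has order \<open>t + n\<close>, and a density has \<open>2 t\<close> derivatives.  So \<open>n < t\<close> is exactly what
  makes all the coordinates of the jet that occur differentiable.
\<close>

lemma partial_along_jet_has_derivative:
  assumes q: "smooth_density q" and "n < t" "x \<in> X"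
  shows "(partial_along_jet q k n has_real_derivative partial_along_jet q k (Suc n) x) (at x)"
  unfolding partial_along_jet_def funpow.simps o_def
proof (rule total_deriv_along_jet[OF iterate_total_deriv_in_diff_alg
      order_at_most_total_deriv_iterate[OF open_X order_at_most_partial_q[OF order_phi]]])
  show "(deriv ^^ j) q differentiable (at y)" if "y \<in> X" "j \<le> t + n" for y j
    using q that \<open>n < t\<close> by (auto simp: smooth_density_def times_cont_differentiable_on_def)
qed (use assms smooth_densityD(1) in auto)

lemma continuous_on_partial_along_jet:
  assumes q: "smooth_density q" and "n \<le> t"
  shows "continuous_on X (partial_along_jet q k n)"
proof -
  define f where "f = (total_deriv ^^ n) (partial_q k \<phi>)"
  \<comment> \<open>Beyond \<open>2 t\<close> the jet need not be continuous; these coordinates do not matter and are set to \<open>0\<close>.\<close>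
  define \<gamma> where "\<gamma> = (\<lambda>x j. if j \<le> 2 * t then jet q x j else 0)"
  have "order_at_most X (t + n) f"
    unfolding f_def
    by (rule order_at_most_total_deriv_iterate[OF open_X order_at_most_partial_q[OF order_phi]])
  then have "f x (\<gamma> x) = partial_along_jet q k n x" if "x \<in> X" for x
    using smooth_densityD(1)[OF q that] that \<open>n \<le> t\<close>
    unfolding order_at_most_def partial_along_jet_def f_def by (auto simp: \<gamma>_def jet_def)
  moreover have "continuous_on X (\<lambda>x. f x (\<gamma> x))"
  proof (rule continuous_on_curve[where X = X and f = f and \<xi> = "\<lambda>x. x" and \<gamma> = \<gamma>])
    show "separately_smooth X f"
      unfolding f_def by (rule diff_alg_smooth[OF iterate_total_deriv_in_diff_alg])
    show "continuous_on X (\<lambda>x. \<gamma> x j)" for j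
      using smooth_densityD(3)[OF q, of j] by (cases "j \<le> 2 * t") (simp_all add: \<gamma>_def jet_def)
  qed (use smooth_densityD(1)[OF q] in \<open>auto simp: \<gamma>_def jet_def\<close>)
  ultimately show ?thesis
    by (simp cong: continuous_on_cong)
qed

lemma deriv_iterate_partial:
  assumes q: "smooth_density q" and "n \<le> t" "x \<in> X"
  shows "(deriv ^^ n) (\<lambda>y. partial_q k \<phi> y (jet q y)) x = partial_along_jet q k n x"
  using assms(2,3)
proof (induction n arbitrary: x)
  case (Suc n)
  then have "deriv ((deriv ^^ n) (\<lambda>y. partial_q k \<phi> y (jet q y))) x = deriv (partial_along_jet q k n) x"
    by (intro deriv_cong_ev eventually_mono[OF eventually_nhds_in_open[OF open_X]]) auto
  also have "\<dots> = partial_along_jet q k (Suc n) x"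
    using partial_along_jet_has_derivative[OF q, of n x k] Suc.prems by (intro DERIV_imp_deriv) auto
  finally show ?case by simp
qed (simp add: partial_along_jet_def)

section \<open>The score difference as a concavity gap minus a derivative\<close>

text \<open>
  The Euler--Lagrange expression of \<open>\<phi>\<close>, which is the generated score as a function of the density.
\<close>

definition euler_lagrange :: "(real \<Rightarrow> real) \<Rightarrow> real \<Rightarrow> real" where
  "euler_lagrange q x = (\<Sum>k\<le>t. (-1) ^ k * partial_along_jet q k k x)"

lemma generated_score_eq_euler_lagrange:
  assumes "smooth_density (dens Q)" "x \<in> X"
  shows "generated_score \<phi> t dens x Q = euler_lagrange (dens Q) x"
  unfolding generated_score_def euler_lagrange_def atMost_atLeast0
  using deriv_iterate_partial[OF assms(1) _ assms(2)] by (intro sum.cong) auto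

text \<open>
  Let \<open>E\<^sub>r\<close> be the sum of \<open>(-1)\<^sup>k\<^sup>-\<^sup>r\<close> times the derivative of order \<open>k - r\<close> of \<open>\<partial>\<phi>/\<partial>q\<^sub>k\<close> along
  the jet, over \<open>k\<close> from \<open>r\<close> to \<open>t\<close>.  Then \<open>E\<^sub>0\<close> is the score, and the lemma says that \<open>B\<^sub>r \<phi> = E\<^sub>r\<^sub>+\<^sub>1\<close>.
\<close>

lemma boundary_op_jet: "boundary_op t r \<phi> x (jet q x) =
    (\<Sum>k=Suc r..t. (-1) ^ (k - Suc r) * partial_along_jet q k (k - Suc r) x)"
  unfolding boundary_op_def partial_along_jet_def by simp

text \<open>
  In the notation above this is the recursion \<open>(B\<^sub>r \<phi>)' = \<partial>\<phi>/\<partial>q\<^sub>r - E\<^sub>r\<close>: differentiation turns the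
  orders \<open>k - 1 - r\<close> into \<open>k - r\<close>, which gives \<open>E\<^sub>r\<close> without its first term and with opposite sign.
\<close>

lemma boundary_op_has_derivative:
  assumes q: "smooth_density q" and x: "x \<in> X" and r: "r < t"
  shows "((\<lambda>y. boundary_op t r \<phi> y (jet q y)) has_real_derivative
           partial_along_jet q r 0 x - (\<Sum>k=r..t. (-1) ^ (k - r) * partial_along_jet q k (k - r) x)) (at x)"
proof -
  have "((\<lambda>y. boundary_op t r \<phi> y (jet q y)) has_real_derivative
      (\<Sum>k=Suc r..t. (-1) ^ (k - Suc r) * partial_along_jet q k (Suc (k - Suc r)) x)) (at x)"
    unfolding boundary_op_jet using r
    by (intro DERIV_sum DERIV_cmult partial_along_jet_has_derivative[OF q _ x]) auto
  moreover have "(\<Sum>k=Suc r..t. (-1) ^ (k - Suc r) * partial_along_jet q k (Suc (k - Suc r)) x) =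
      - (\<Sum>k=Suc r..t. (-1) ^ (k - r) * partial_along_jet q k (k - r) x)"
    unfolding sum_negf[symmetric]
  proof (intro sum.cong refl)
    fix k assume "k \<in> {Suc r..t}"
    then have "k - r = Suc (k - Suc r)" by auto
    then show "(-1) ^ (k - Suc r) * partial_along_jet q k (Suc (k - Suc r)) x =
        - ((-1) ^ (k - r) * partial_along_jet q k (k - r) x)"
      by simp
  qed
  ultimately show ?thesis
    using r by (simp add: sum.atLeast_Suc_atMost)
qed

text \<open>
  With the recursion above, the derivative of \<open>\<Sum>\<^sub>r p\<^sup>(\<^sup>r\<^sup>) E\<^sub>r\<^sub>+\<^sub>1\<close> is the sum of the terms
  \<open>p\<^sup>(\<^sup>r\<^sup>+\<^sup>1\<^sup>) E\<^sub>r\<^sub>+\<^sub>1 - p\<^sup>(\<^sup>r\<^sup>) E\<^sub>r\<close>, which telescope, and of \<open>p\<^sup>(\<^sup>r\<^sup>) \<partial>\<phi>/\<partial>q\<^sub>r\<close>.  This is repeated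
  integration by parts of \<open>p\<close> times the score, in differential form.
\<close>

lemma integration_by_parts_identity:
  assumes p: "smooth_density p" and q: "smooth_density q" and x: "x \<in> X"
  shows "((\<lambda>y. \<Sum>r<t. (deriv ^^ r) p y * boundary_op t r \<phi> y (jet q y)) has_real_derivative
           (\<Sum>r\<le>t. (deriv ^^ r) p x * partial_along_jet q r 0 x) - p x * euler_lagrange q x) (at x)"
proof -
  define E where "E r = (\<Sum>k=r..t. (-1) ^ (k - r) * partial_along_jet q k (k - r) x)" for r
  define P where "P r = (deriv ^^ r) p x" for r
  have "((\<lambda>y. \<Sum>r<t. (deriv ^^ r) p y * boundary_op t r \<phi> y (jet q y)) has_real_derivative
     (\<Sum>r<t. P (Suc r) * E (Suc r) + (partial_along_jet q r 0 x - E r) * P r)) (at x)"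
  proof (intro DERIV_sum)
    fix r assume "r \<in> {..<t}"
    then have "((deriv ^^ r) p has_real_derivative P (Suc r)) (at x)"
      unfolding P_def by (intro smooth_densityD(2)[OF p _ x]) auto
    moreover have "((\<lambda>y. boundary_op t r \<phi> y (jet q y)) has_real_derivative partial_along_jet q r 0 x - E r) (at x)"
      unfolding E_def using \<open>r \<in> {..<t}\<close> by (intro boundary_op_has_derivative[OF q x]) auto
    ultimately have "((\<lambda>y. (deriv ^^ r) p y * boundary_op t r \<phi> y (jet q y)) has_real_derivative
        P (Suc r) * boundary_op t r \<phi> x (jet q x) + (partial_along_jet q r 0 x - E r) * (deriv ^^ r) p x) (at x)"
      by (rule DERIV_mult)
    moreover have "boundary_op t r \<phi> x (jet q x) = E (Suc r)"
      by (simp add: boundary_op_jet E_def)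
    ultimately show "((\<lambda>y. (deriv ^^ r) p y * boundary_op t r \<phi> y (jet q y)) has_real_derivative
        P (Suc r) * E (Suc r) + (partial_along_jet q r 0 x - E r) * P r) (at x)"
      by (simp add: P_def)
  qed
  moreover have "(\<Sum>r<t. P (Suc r) * E (Suc r) + (partial_along_jet q r 0 x - E r) * P r) =
      (\<Sum>r\<le>t. P r * partial_along_jet q r 0 x) - p x * euler_lagrange q x"
  proof -
    have "(\<Sum>r<t. P (Suc r) * E (Suc r) + (partial_along_jet q r 0 x - E r) * P r) =
        (\<Sum>r<t. P (Suc r) * E (Suc r) - P r * E r) + (\<Sum>r<t. P r * partial_along_jet q r 0 x)"
      unfolding sum.distrib[symmetric] by (intro sum.cong) (auto simp: algebra_simps)
    also have "(\<Sum>r<t. P (Suc r) * E (Suc r) - P r * E r) = P t * E t - P 0 * E 0"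
      by (rule sum_lessThan_telescope)
    finally have "(\<Sum>r<t. P (Suc r) * E (Suc r) + (partial_along_jet q r 0 x - E r) * P r) =
        P t * E t - P 0 * E 0 + (\<Sum>r<t. P r * partial_along_jet q r 0 x)" .
    moreover have "E t = partial_along_jet q t 0 x" "E 0 = euler_lagrange q x" "P 0 = p x"
      by (simp_all add: E_def euler_lagrange_def P_def atMost_atLeast0)
    ultimately show ?thesis by (simp flip: lessThan_Suc_atMost)
  qed
  ultimately show ?thesis by (simp add: P_def)
qed

text \<open>
  How far the tangent of \<open>\<phi>(x, \<cdot>)\<close> at the jet of \<open>q\<close>, evaluated at the jet of \<open>p\<close>, lies above \<open>\<phi>\<close>.  By
  homogeneity the tangent is linear, without a constant term.
\<close>

definition concavity_gap :: "(real \<Rightarrow> real) \<Rightarrow> (real \<Rightarrow> real) \<Rightarrow> real \<Rightarrow> real" where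
  "concavity_gap p q x = (\<Sum>r\<le>t. (deriv ^^ r) p x * partial_along_jet q r 0 x) - \<phi> x (jet p x)"

lemma directional_derivative:
  assumes x: "x \<in> X" and q: "0 < q 0" and p: "0 < p 0"
  shows "((\<lambda>s. \<phi> x (\<lambda>j. q j + s * p j)) has_real_derivative
           (\<Sum>j\<le>t. p j * partial_q j \<phi> x q)) (at 0)"
proof -
  define T where "T = {s. 0 < q 0 + s * p 0}"
  have "open T"
    unfolding T_def by (intro open_Collect_less continuous_intros)
  moreover have "0 \<in> T" using q by (simp add: T_def)
  moreover have "\<phi> \<in> diff_alg X \<phi>" by (intro diff_alg.generator iterated_partials.base)
  ultimately have "((\<lambda>s. \<phi> x (\<lambda>j. q j + s * p j)) has_real_derivative
     0 * partial_x \<phi> x (\<lambda>j. q j + 0 * p j) +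
     (\<Sum>j\<le>t. p j * partial_q j \<phi> x (\<lambda>j. q j + 0 * p j))) (at 0)"
    using x
    by (intro chain_rule[OF open_X _ diff_alg_smooth order_phi, of T])
      (auto simp: T_def intro!: derivative_eq_intros)
  then show ?thesis by simp
qed

text \<open>
  Along the ray \<open>(1 + s) p\<close> the function \<open>\<phi>\<close> is linear in \<open>s\<close>.
\<close>

lemma euler_identity:
  assumes hom: "one_homogeneous X \<phi>" and x: "x \<in> X" and p: "0 < p 0"
  shows "(\<Sum>j\<le>t. p j * partial_q j \<phi> x p) = \<phi> x p"
proof -
  have "((\<lambda>s. \<phi> x (\<lambda>j. p j + s * p j)) has_real_derivative \<phi> x p) (at 0)"
  proof (rule has_field_derivative_transform_within_open[of "\<lambda>s. (1 + s) * \<phi> x p" _ _ "{-1<..}"])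
    show "(1 + s) * \<phi> x p = \<phi> x (\<lambda>j. p j + s * p j)" if "s \<in> {-1<..}" for s
      using hom x p that unfolding one_homogeneous_def
      by (auto simp: distrib_right dest!: bspec[of _ _ x] spec[of _ p] spec[of _ "1 + s"])
  qed (auto intro!: derivative_eq_intros)
  then show ?thesis
    using directional_derivative[where p = p and q = p, OF x p p] DERIV_unique by blast
qed

text \<open>
  Superadditivity and homogeneity bound the difference quotient at \<open>q\<close> in direction \<open>p\<close> from below
  by \<open>\<phi>(p)\<close>.
\<close>

lemma tangent_inequality:
  assumes hom: "one_homogeneous X \<phi>" and conc: "q_concave X \<phi>"
    and x: "x \<in> X" and q: "0 < q 0" and p: "0 < p 0"
  shows "\<phi> x p \<le> (\<Sum>j\<le>t. p j * partial_q j \<phi> x q)"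
proof (rule tendsto_le[of "at_right 0"])
  show "((\<lambda>s. (\<phi> x (\<lambda>j. q j + s * p j) - \<phi> x q) / s) \<longlongrightarrow>
      (\<Sum>j\<le>t. p j * partial_q j \<phi> x q)) (at_right 0)"
    using directional_derivative[where p = p and q = q, OF x q p] tendsto_within_subset
    by (fastforce simp: has_field_derivative_iff)
  show "\<forall>\<^sub>F s in at_right 0. \<phi> x p \<le> (\<phi> x (\<lambda>j. q j + s * p j) - \<phi> x q) / s"
    using eventually_at_right_less[of "0 :: real"]
  proof eventually_elim
    case (elim s)
    have "\<phi> x q + \<phi> x (\<lambda>j. s * p j) \<le> \<phi> x (\<lambda>j. q j + s * p j)"
      using conc x q p elim unfolding q_concave_def by auto
    moreover have "\<phi> x (\<lambda>j. s * p j) = s * \<phi> x p"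
      using hom x p elim unfolding one_homogeneous_def by auto
    ultimately show ?case using elim by (simp add: field_simps)
  qed
qed auto

text \<open>
  Strictness is lost in the limit of difference quotients, so it is regained from the weak
  inequality at the point \<open>p + q\<close>: there \<open>\<phi>(p) + \<phi>(q) < \<phi>(p + q)\<close>, while the tangent at \<open>q\<close> takes
  the value \<open>\<phi>(q)\<close> at \<open>q\<close>.
\<close>

lemma strict_tangent_inequality:
  assumes hom: "one_homogeneous X \<phi>" and strict: "q_strictly_concave X t \<phi>"
    and x: "x \<in> X" and q: "0 < q 0" and p: "0 < p 0"
    and indep: "lin_indep_upto t p q"
  shows "\<phi> x p < (\<Sum>j\<le>t. p j * partial_q j \<phi> x q)"
proof -
  have conc: "q_concave X \<phi>" using strict by (simp add: q_strictly_concave_def)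
  have "\<phi> x p + \<phi> x q < \<phi> x (\<lambda>j. p j + q j)"
    using strict x q p indep by (simp add: q_strictly_concave_def)
  also have "\<dots> \<le> (\<Sum>j\<le>t. (p j + q j) * partial_q j \<phi> x q)"
    using q p by (intro tangent_inequality[OF hom conc x]) auto
  also have "\<dots> = (\<Sum>j\<le>t. p j * partial_q j \<phi> x q) + \<phi> x q"
    using euler_identity[where p = q, OF hom x q] by (simp add: distrib_right sum.distrib)
  finally show ?thesis by simp
qed

text \<open>
  The difference of two integrations by parts, one along \<open>q\<close> and one along \<open>p\<close>; for the latter
  Euler's identity identifies the remaining sum with \<open>\<phi>\<close> at the jet of \<open>p\<close>.
\<close>

lemma d_b_has_derivative:
  assumes hom: "one_homogeneous X \<phi>"
    and p: "smooth_density p" and q: "smooth_density q" and x: "x \<in> X"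
  shows "(d_b \<phi> t p q has_real_derivative
           concavity_gap p q x - p x * (euler_lagrange q x - euler_lagrange p x)) (at x)"
proof -
  have euler: "(\<Sum>r\<le>t. (deriv ^^ r) p x * partial_along_jet p r 0 x) = \<phi> x (jet p x)"
    using euler_identity[where p = "jet p x", OF hom x] smooth_densityD(1)[OF p x]
    by (simp add: partial_along_jet_def jet_def)
  have "d_b \<phi> t p q = (\<lambda>y. (\<Sum>r<t. (deriv ^^ r) p y * boundary_op t r \<phi> y (jet q y)) -
      (\<Sum>r<t. (deriv ^^ r) p y * boundary_op t r \<phi> y (jet p y)))"
    by (auto simp: d_b_def sum_subtractf right_diff_distrib)
  then show ?thesis
    using DERIV_diff[OF integration_by_parts_identity[OF p q x] integration_by_parts_identity[OF p p x]]
    by (simp add: concavity_gap_def euler algebra_simps)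
qed

lemma continuous_on_euler_lagrange: "smooth_density q \<Longrightarrow> continuous_on X (euler_lagrange q)"
  unfolding euler_lagrange_def by (intro continuous_intros continuous_on_partial_along_jet) auto

lemma continuous_on_concavity_gap:
  assumes hom: "one_homogeneous X \<phi>" and p: "smooth_density p" and q: "smooth_density q"
  shows "continuous_on X (concavity_gap p q)"
proof -
  have "concavity_gap p q x = (\<Sum>r\<le>t. (deriv ^^ r) p x * (partial_along_jet q r 0 x - partial_along_jet p r 0 x))" if "x \<in> X" for x
    using euler_identity[where p = "jet p x", OF hom that] smooth_densityD(1)[OF p that]
    by (simp add: concavity_gap_def partial_along_jet_def jet_def right_diff_distrib sum_subtractf)
  moreover have "continuous_on X (\<lambda>x. \<Sum>r\<le>t. (deriv ^^ r) p x * (partial_along_jet q r 0 x - partial_along_jet p r 0 x))"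
    using smooth_densityD(3)[OF p]
    by (intro continuous_intros continuous_on_partial_along_jet[OF q] continuous_on_partial_along_jet[OF p]) auto
  ultimately show ?thesis
    by (simp cong: continuous_on_cong)
qed

lemma concavity_gap_nonneg:
  assumes "one_homogeneous X \<phi>" "q_concave X \<phi>" "smooth_density p" "smooth_density q" "x \<in> X"
  shows "0 \<le> concavity_gap p q x"
  using tangent_inequality[where p = "jet p x" and q = "jet q x", OF assms(1,2,5)]
    smooth_densityD(1)[OF assms(3,5)] smooth_densityD(1)[OF assms(4,5)]
  by (simp add: concavity_gap_def partial_along_jet_def jet_def)

text \<open>
  A vanishing gap forces linearly dependent jets, and \<open>t \<ge> 1\<close> makes their first two coordinates
  a dependent pair of vectors in the plane.
\<close>

lemma concavity_gap_zero_imp_wronskian_zero: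
  assumes "one_homogeneous X \<phi>" "q_strictly_concave X t \<phi>" "smooth_density p" "smooth_density q"
    and "x \<in> X" "concavity_gap p q x = 0" "1 \<le> t"
  shows "p x * deriv q x = deriv p x * q x"
proof -
  have "\<not> lin_indep_upto t (jet p x) (jet q x)"
    using strict_tangent_inequality[where p = "jet p x" and q = "jet q x", OF assms(1,2,5)]
      smooth_densityD(1)[OF assms(3,5)] smooth_densityD(1)[OF assms(4,5)] assms(6)
    by (auto simp: concavity_gap_def partial_along_jet_def jet_def)
  then obtain \<alpha> \<beta> where ne: "\<alpha> \<noteq> 0 \<or> \<beta> \<noteq> 0" and
    eq: "\<And>i. i \<le> t \<Longrightarrow> \<alpha> * jet p x i + \<beta> * jet q x i = 0"
    unfolding lin_indep_upto_def by blast
  have "\<alpha> * p x + \<beta> * q x = 0" "\<alpha> * deriv p x + \<beta> * deriv q x = 0"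
    using eq[of 0] eq[of 1] \<open>1 \<le> t\<close> by (auto simp: jet_def)
  then have "\<alpha> * (p x * deriv q x - deriv p x * q x) = 0" "\<beta> * (p x * deriv q x - deriv p x * q x) = 0"
    by algebra+
  then show ?thesis using ne by auto
qed

end

section \<open>Integrating up to the end-points\<close>

text \<open>
  On compact subintervals this is the fundamental theorem of calculus.  The integral of \<open>h\<close>
  converges as these exhaust the interval, hence so does that of \<open>G\<close>, and the sign of \<open>G\<close> turns
  this improper convergence into integrability.
\<close>

lemma integral_eq_of_vanishing_boundary:
  fixes a b :: ereal and F G h :: "real \<Rightarrow> real"
  assumes "a < b"
    and deriv: "\<And>x. x \<in> einterval a b \<Longrightarrow> (F has_real_derivative G x - h x) (at x)"
    and G: "continuous_on (einterval a b) G" "\<And>x. x \<in> einterval a b \<Longrightarrow> 0 \<le> G x"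
    and h: "continuous_on (einterval a b) h" "set_integrable lborel (einterval a b) h"
    and lim_a: "((\<lambda>x. F (real_of_ereal x)) \<longlongrightarrow> 0) (at_right a)"
    and lim_b: "((\<lambda>x. F (real_of_ereal x)) \<longlongrightarrow> 0) (at_left b)"
  shows "set_integrable lborel (einterval a b) G"
    and "(LBINT x:einterval a b. G x) = (LBINT x:einterval a b. h x)"
proof -
  obtain u l :: "nat \<Rightarrow> real" where
    approx: "einterval a b = (\<Union>i. {l i .. u i})"
    "incseq u" "decseq l" "\<And>i. l i < u i" "\<And>i. a < l i" "\<And>i. u i < b"
    "l \<longlonglongrightarrow> a" "u \<longlonglongrightarrow> b"
    by (blast intro: einterval_Icc_approximation[OF \<open>a < b\<close>])
  have sub: "{l i..u i} \<subseteq> einterval a b" for i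
    using approx(1) by blast
  have "filterlim (\<lambda>i. ereal (l i)) (at_right a) sequentially"
    using approx(5,7) by (auto simp: filterlim_at less_imp_neq[symmetric])
  from filterlim_compose[OF lim_a this] have Fl: "(\<lambda>i. F (l i)) \<longlonglongrightarrow> 0"
    by simp
  have "filterlim (\<lambda>i. ereal (u i)) (at_left b) sequentially"
    using approx(6,8) by (auto simp: filterlim_at less_imp_neq)
  from filterlim_compose[OF lim_b this] have Fu: "(\<lambda>i. F (u i)) \<longlonglongrightarrow> 0"
    by simp
  have int: "set_integrable lborel {l i..u i} G" "set_integrable lborel {l i..u i} h" for i
    using G(1) h(1) sub[of i]
    by (auto intro!: borel_integrable_atLeastAtMost' intro: continuous_on_subset)
  have G_eq: "(LBINT x=l i..u i. G x) = F (u i) - F (l i) + (LBINT x=l i..u i. h x)" for i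
  proof -
    have "l i \<le> u i" using approx(4)[of i] by simp
    have "(LBINT x=l i..u i. G x - h x) = F (u i) - F (l i)"
    proof (rule interval_integral_FTC_finite)
      show "continuous_on {min (l i) (u i)..max (l i) (u i)} (\<lambda>x. G x - h x)"
        using G(1) h(1) sub[of i] \<open>l i \<le> u i\<close>
        by (auto intro!: continuous_on_diff intro: continuous_on_subset)
      show "(F has_vector_derivative G x - h x) (at x within {min (l i) (u i)..max (l i) (u i)})"
        if "min (l i) (u i) \<le> x" "x \<le> max (l i) (u i)" for x
      proof -
        have "x \<in> einterval a b"
          using sub[of i] that \<open>l i \<le> u i\<close> by auto
        then show ?thesis
          using deriv[of x]
          by (simp add: has_real_derivative_iff_has_vector_derivative has_vector_derivative_at_within)
      qed
    qed
    then show ?thesis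
      using int[of i] \<open>l i \<le> u i\<close>
      by (simp add: interval_integral_Icc set_integral_diff)
  qed
  have "(\<lambda>i. LBINT x=l i..u i. h x) \<longlonglongrightarrow> (LBINT x=a..b. h x)"
    by (rule interval_integral_Icc_approx_integrable[OF \<open>a < b\<close> approx h(2)])
  from tendsto_add[OF tendsto_diff[OF Fu Fl] this]
  have lim: "(\<lambda>i. LBINT x=l i..u i. G x) \<longlonglongrightarrow> (LBINT x=a..b. h x)"
    by (simp add: G_eq)
  have nonneg: "AE x in lborel. a < ereal x \<longrightarrow> ereal x < b \<longrightarrow> 0 \<le> G x"
    using G(2) by (auto simp: einterval_iff)
  have meas: "set_borel_measurable lborel (einterval a b) G"
    using G(1) borel_measurable_continuous_on_indicator[of "einterval a b" G]
    by (simp add: set_borel_measurable_def)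
  note res = interval_integral_Icc_approx_nonneg[OF \<open>a < b\<close> approx int(1) nonneg meas lim]
  show "set_integrable lborel (einterval a b) G" by (rule res(1))
  show "(LBINT x:einterval a b. G x) = (LBINT x:einterval a b. h x)"
    using res(2) \<open>a < b\<close> by (simp add: interval_lebesgue_integral_le_eq)
qed

lemma set_integral_continuous_nonneg_eq_0:
  fixes G :: "real \<Rightarrow> real"
  assumes X: "open X" and G: "continuous_on X G" "\<And>x. x \<in> X \<Longrightarrow> 0 \<le> G x"
    "set_integrable lborel X G" "(LBINT x:X. G x) = 0" and x: "x \<in> X"
  shows "G x = 0"
proof -
  have "AE x in lborel. indicator X x *\<^sub>R G x = 0"
    using G(2-4) integral_nonneg_eq_0_iff_AE[of lborel "\<lambda>x. indicator X x *\<^sub>R G x"]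
    by (auto simp: set_integrable_def set_lebesgue_integral_def indicator_def)
  then have "AE x in lborel. x \<in> X \<longrightarrow> G x = 0"
    by eventually_elim (auto simp: indicator_def split: if_splits)
  then have ae: "AE x in lebesgue. x \<in> X \<longrightarrow> x \<in> - (X \<inter> G -` (- {0}))"
    by (auto elim!: eventually_mono dest!: AE_completion)
  have "open (X \<inter> G -` (- {0}))"
    using G(1) X by (auto intro!: continuous_open_preimage)
  then have "closed (- (X \<inter> G -` (- {0})))"
    by (rule closed_Compl)
  from mem_closed_if_AE_lebesgue_open[OF X this ae x] have "x \<in> - (X \<inter> G -` (- {0}))" .
  then show ?thesis using x by simp
qed

section \<open>Proportional densities\<close>

text \<open>
  The numerator of the derivative of \<open>p / q\<close> is the Wronskian.
\<close>

lemma proportional_if_wronskian_zero: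
  fixes p q :: "real \<Rightarrow> real"
  assumes "convex X"
    and p: "\<And>x. x \<in> X \<Longrightarrow> (p has_real_derivative p' x) (at x)"
    and q: "\<And>x. x \<in> X \<Longrightarrow> (q has_real_derivative q' x) (at x)" "\<And>x. x \<in> X \<Longrightarrow> 0 < q x"
    and wronskian: "\<And>x. x \<in> X \<Longrightarrow> p x * q' x = p' x * q x"
  shows "\<exists>c. \<forall>x\<in>X. p x = c * q x"
proof -
  have "((\<lambda>x. p x / q x) has_field_derivative 0) (at x within X)" if "x \<in> X" for x
    using DERIV_divide[OF p q(1), of x] q(2)[of x] wronskian[of x] that
    by (simp add: has_field_derivative_at_within)
  with \<open>convex X\<close> obtain c where "\<forall>x\<in>X. p x / q x = c"
    using has_field_derivative_zero_constant by blast
  then show ?thesis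
    using q(2) by (metis less_irrefl nonzero_divide_eq_eq)
qed

lemma proportional_probability_densities_equal:
  assumes P: "prob_space (density M (\<lambda>x. ennreal (p x)))"
    and Q: "prob_space (density M (\<lambda>x. ennreal (q x)))"
    and meas: "q \<in> borel_measurable M"
    and proportional: "\<And>x. x \<in> space M \<Longrightarrow> p x = c * q x"
    and pos: "\<And>x. x \<in> space M \<Longrightarrow> 0 < p x" "\<And>x. x \<in> space M \<Longrightarrow> 0 < q x"
  shows "density M (\<lambda>x. ennreal (p x)) = density M (\<lambda>x. ennreal (q x))"
proof -
  have "space M \<noteq> {}"
    using prob_space.not_empty[OF P] by simp
  then obtain x0 where "x0 \<in> space M" by blast
  then have "0 < c"
    using proportional pos by (metis zero_less_mult_pos2)
  have p: "ennreal (p x) = ennreal c * ennreal (q x)" if "x \<in> space M" for x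
    using proportional[OF that] pos(2)[OF that] \<open>0 < c\<close> by (simp add: ennreal_mult)
  have "(\<integral>\<^sup>+ x. ennreal (q x) \<partial>M) = 1"
    using prob_space.emeasure_space_1[OF Q] meas by (simp add: emeasure_density cong: nn_integral_cong)
  moreover have "(\<integral>\<^sup>+ x. ennreal (p x) \<partial>M) = ennreal c * (\<integral>\<^sup>+ x. ennreal (q x) \<partial>M)"
    using meas by (subst nn_integral_cmult[symmetric]) (auto intro!: nn_integral_cong p)
  moreover have "(\<lambda>x. ennreal (p x)) \<in> borel_measurable M"
    using meas by (subst measurable_cong[OF p]) auto
  then have "(\<integral>\<^sup>+ x. ennreal (p x) \<partial>M) = 1"
    using prob_space.emeasure_space_1[OF P] by (simp add: emeasure_density cong: nn_integral_cong)
  ultimately have "c = 1" by (simp add: \<open>0 < c\<close> less_imp_le)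
  then have "AE x in M. ennreal (p x) = ennreal (q x)"
    using proportional by simp
  then show ?thesis
    using \<open>(\<lambda>x. ennreal (p x)) \<in> borel_measurable M\<close> meas by (intro density_cong) auto
qed

theorem corollary9p2:
  fixes a b :: ereal and X :: "real set" and t :: nat
    and \<phi> :: "real \<Rightarrow> (nat \<Rightarrow> real) \<Rightarrow> real"
    and \<P> :: "real measure set" and dens :: "real measure \<Rightarrow> real \<Rightarrow> real"
    and S :: "real \<Rightarrow> real measure \<Rightarrow> real"
  assumes "a < b" and "X = einterval a b"
    and "t \<ge> 1"
    and "q_function X t \<phi>" and "one_homogeneous X \<phi>" and "q_concave X \<phi>"
    and "\<And>P. P \<in> \<P> \<Longrightarrow> smooth_distribution X t P (dens P)"
    and "\<And>x Q. x \<in> X \<Longrightarrow> Q \<in> \<P> \<Longrightarrow> S x Q = generated_score \<phi> t dens x Q"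
    and "\<And>P Q. P \<in> \<P> \<Longrightarrow> Q \<in> \<P> \<Longrightarrow> finite_expected_score X dens S P Q"
    and "\<And>P Q. P \<in> \<P> \<Longrightarrow> Q \<in> \<P> \<Longrightarrow> has_d_plus b \<phi> t (dens P) (dens Q) 0"
    and "\<And>P Q. P \<in> \<P> \<Longrightarrow> Q \<in> \<P> \<Longrightarrow> has_d_minus a \<phi> t (dens P) (dens Q) 0"
  shows "proper_score X dens \<P> S \<and>
    (q_strictly_concave X t \<phi> \<longrightarrow> strictly_proper_score X dens \<P> S)"
proof -
  note X = \<open>X = einterval a b\<close> and hom = \<open>one_homogeneous X \<phi>\<close>
  interpret smooth_qfun X t \<phi>
    by unfold_locales (use assms in auto)
  have dens: "smooth_density (dens P)" if "P \<in> \<P>" for P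
    using assms(7)[OF that] by (simp add: smooth_density_def smooth_distribution_def)
  have S_eq: "S x Q = euler_lagrange (dens Q) x" if "x \<in> X" "Q \<in> \<P>" for x Q
    using assms(8)[OF that] generated_score_eq_euler_lagrange[where dens = dens, OF dens[OF that(2)] that(1)] by simp
  have cont: "continuous_on X (dens P)" if "P \<in> \<P>" for P
    using smooth_densityD(3)[OF dens[OF that], of 0] by simp

  have gap_integral: "set_integrable lborel X (concavity_gap (dens P) (dens Q))"
    "(LBINT x:X. concavity_gap (dens P) (dens Q) x) =
      expected_score X dens S P Q - expected_score X dens S P P"
    if P: "P \<in> \<P>" and Q: "Q \<in> \<P>" for P Q
  proof -
    let ?h = "\<lambda>x. dens P x * (euler_lagrange (dens Q) x - euler_lagrange (dens P) x)"
    have integrable: "set_integrable lborel X (\<lambda>x. dens P x * euler_lagrange (dens R) x)"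
      and score: "(LBINT x:X. dens P x * euler_lagrange (dens R) x) = expected_score X dens S P R"
      if "R \<in> \<P>" for R
      using assms(9)[OF P that] S_eq that
      unfolding finite_expected_score_def expected_score_def
      by (auto simp: X cong: set_integrable_cong intro!: set_lebesgue_integral_cong)
    have h: "set_integrable lborel X ?h"
      "(LBINT x:X. ?h x) = expected_score X dens S P Q - expected_score X dens S P P"
      using set_integral_diff[OF integrable[OF Q] integrable[OF P]] score[OF P] score[OF Q]
      by (simp_all add: right_diff_distrib)
    have "((\<lambda>x. d_b \<phi> t (dens P) (dens Q) (real_of_ereal x)) \<longlongrightarrow> 0) (at_left b)"
      using tendsto_minus[OF assms(10)[OF P Q, unfolded has_d_plus_def]] by simp
    moreover have "((\<lambda>x. d_b \<phi> t (dens P) (dens Q) (real_of_ereal x)) \<longlongrightarrow> 0) (at_right a)"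
      using assms(11)[OF P Q] by (simp add: has_d_minus_def)
    moreover have "continuous_on X ?h"
      by (intro continuous_intros cont continuous_on_euler_lagrange dens P Q)
    ultimately show "set_integrable lborel X (concavity_gap (dens P) (dens Q))"
      "(LBINT x:X. concavity_gap (dens P) (dens Q) x) =
        expected_score X dens S P Q - expected_score X dens S P P"
      using integral_eq_of_vanishing_boundary[OF \<open>a < b\<close>, folded X,
          where F = "d_b \<phi> t (dens P) (dens Q)" and G = "concavity_gap (dens P) (dens Q)" and h = ?h]
        d_b_has_derivative[OF hom dens[OF P] dens[OF Q]]
        continuous_on_concavity_gap[OF hom dens[OF P] dens[OF Q]]
        concavity_gap_nonneg[OF hom assms(6) dens[OF P] dens[OF Q]] h
      by simp_all
  qed

  have proper: "proper_score X dens \<P> S"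
    unfolding proper_score_def
  proof (intro ballI)
    fix P Q assume PQ: "P \<in> \<P>" "Q \<in> \<P>"
    have "0 \<le> (LBINT x:X. concavity_gap (dens P) (dens Q) x)"
      using concavity_gap_nonneg[OF hom assms(6) dens[OF PQ(1)] dens[OF PQ(2)]]
      unfolding set_lebesgue_integral_def
      by (intro Bochner_Integration.integral_nonneg) (auto simp: indicator_def)
    then show "expected_score X dens S P P \<le> expected_score X dens S P Q"
      using gap_integral(2)[OF PQ] by simp
  qed

  \<comment> \<open>If the expected scores agree, the gap vanishes, so the two densities have dependent
    jets everywhere and are proportional.\<close>
  have "Q = P"
    if strict: "q_strictly_concave X t \<phi>" and PQ: "P \<in> \<P>" "Q \<in> \<P>"
      and eq: "expected_score X dens S P Q = expected_score X dens S P P" for P Q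
  proof -
    let ?p = "dens P" and ?q = "dens Q" and ?M = "restrict_space lborel X"
    have "(LBINT x:X. concavity_gap ?p ?q x) = 0"
      using gap_integral(2)[OF PQ] eq by simp
    then have "concavity_gap ?p ?q x = 0" if "x \<in> X" for x
      using set_integral_continuous_nonneg_eq_0[OF open_X
          continuous_on_concavity_gap[OF hom dens[OF PQ(1)] dens[OF PQ(2)]]
          concavity_gap_nonneg[OF hom assms(6) dens[OF PQ(1)] dens[OF PQ(2)]] gap_integral(1)[OF PQ]] that
      by blast
    then have "?p x * deriv ?q x = deriv ?p x * ?q x" if "x \<in> X" for x
      using concavity_gap_zero_imp_wronskian_zero[OF hom strict dens[OF PQ(1)] dens[OF PQ(2)] that _ \<open>t \<ge> 1\<close>] that
      by simp
    moreover have "convex X"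
      unfolding X is_interval_convex_1[symmetric] is_interval_1 Ball_def einterval_iff
      by (meson ereal_less_eq(3) less_le_trans le_less_trans)
    moreover have "(dens R has_real_derivative deriv (dens R) x) (at x)" if "R \<in> \<P>" "x \<in> X" for R x
      using smooth_densityD(2)[OF dens[OF that(1)], of 0 x] that \<open>t \<ge> 1\<close> by simp
    ultimately obtain c where c: "\<forall>x\<in>X. ?p x = c * ?q x"
      using proportional_if_wronskian_zero[of X ?p "deriv ?p" ?q "deriv ?q"]
        smooth_densityD(1)[OF dens[OF PQ(2)]] PQ by blast
    have PQ_density: "prob_space R" "R = density ?M (\<lambda>x. ennreal (dens R x))" if "R \<in> \<P>" for R
      using assms(7)[OF that] by (simp_all add: smooth_distribution_def)
    have "density ?M (\<lambda>x. ennreal (?p x)) = density ?M (\<lambda>x. ennreal (?q x))"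
    proof (rule proportional_probability_densities_equal)
      show "prob_space (density ?M (\<lambda>x. ennreal (?p x)))" "prob_space (density ?M (\<lambda>x. ennreal (?q x)))"
        using PQ_density[OF PQ(1)] PQ_density[OF PQ(2)] by simp_all
      show "?q \<in> borel_measurable ?M"
        using borel_measurable_continuous_on_restrict[OF cont[OF PQ(2)]]
        by (simp cong: measurable_cong_sets add: sets_restrict_space)
      show "?p x = c * ?q x" "0 < ?p x" "0 < ?q x" if "x \<in> space ?M" for x
        using that c smooth_densityD(1)[OF dens[OF PQ(1)]] smooth_densityD(1)[OF dens[OF PQ(2)]]
        by (auto simp: space_restrict_space)
    qed
    then show "Q = P"
      using PQ_density(2)[OF PQ(1)] PQ_density(2)[OF PQ(2)] by simp
  qed
  with proper show ?thesis
    by (auto simp: strictly_proper_score_def)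
qed

end
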